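(* Let $m\ge1$ be an integer and $f(z)=\sum_{n\ge0}a_nz^{-n/m}\in\mathbb{C}[[z^{-1/m}]]$ a Gevrey-1 series whose Borel transform $\widetilde f(\zeta)=\sum_{n\ge1}\frac{a_n\zeta^{n/m-1}}{\Gamma(n/m)}$ extends analytically to $\Omega^\star$, with $$\exists A>0,\ \exists B>0,\ \forall\zeta\in\Omega^\star:\ |\widetilde f(\zeta)\zeta^{\frac{m-1}{m}}|\le Ae^{B|\zeta|}.$$ Define the coefficients $d_n$ ($n\ge1$) as follows: for $l=1,\dots,m$ let $\widetilde g_l(\xi)=\big(\frac{\xi}{1-e^{-\xi}}\big)^{\frac lm-1}\sum_{k\ge0}\frac{a_{l+mk}\xi^k}{\Gamma(\frac lm+k)}$ (principal branch), which extends holomorphically to $\Delta$, and let $d_{l+mj}$, $j\ge0$, be given by the Taylor expansion $\widetilde g_l(-\ln s)=\sum_{j\ge0}d_{l+mj}(1-s)^j$ for $s\in D(1,1)$. Then the generalized factorial series $$a_0+\sum_{n=1}^{+\infty}\frac{\Gamma(\frac nm)\Gamma(z)\,d_n}{\Gamma(z+\frac nm)}$$ converges absolutely for $z\in P(\max(B,1))$ and its sum equals the Borel sum $\mathrm{S}_0f(z)=a_0+\int_0^{+\infty}\widetilde f(\zeta)e^{-z\zeta}d\zeta$ there.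
   Context: $\Delta$ is the image of the open disc $D(1,1)=\{s:|s-1|<1\}$ under $s\mapsto-\ln s$ (principal logarithm); $\Delta^\star=\Delta\setminus\{0\}$. $\mathbb{C}_m^\star$ is the $m$-sheeted covering of $\mathbb{C}^\star$: points $x=(|x|,\arg x)$, $\arg x\in\mathbb{R}/2\pi m\mathbb{Z}$, projection $\pi(x)=\dot x=|x|e^{i\arg x}$; $|\arg x|$ uses the representative in $]-m\pi,m\pi]$; $x^{k/m}$ has modulus $|x|^{k/m}$ and argument $\frac km\arg x$; complex values (e.g. $e^{-z\zeta}$, $\Gamma(z)$) are read via the projection. $\Omega^\star=\pi^{-1}(\Delta^\star)$. $P(B)=\{z\in\mathbb{C}_m^\star:|\arg z|\le\pi/2,\ \Re(\dot z)>B\}$. Gevrey-1 means $|a_n|\le CK^n\Gamma(1+n/m)$ for some constants. The Laplace integral is along the ray $\arg\zeta=0$. Equivalently, $\widetilde f(\zeta)=\sum_{n\ge1}d_n(1-e^{-\zeta})^{\frac nm-1}$ on $\Omega^\star$. *)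

theory Defs
  imports "HOL-Analysis.Analysis"
begin

text \<open>The m-sheeted covering of the punctured plane is identified with the
  punctured w-plane via the biholomorphism x \<mapsto> x^(1/m); a point x with
  |arg x| in ]-m pi, m pi] corresponds to w = |x|^(1/m) e^(i arg x / m), and
  the projection is w \<mapsto> w^m.\<close>

definition Delta :: "complex set" where
  "Delta = (\<lambda>s. - Ln s) ` ball 1 1"

text \<open>Omega-star, in the w = zeta^(1/m) coordinate.\<close>
definition Omega_star :: "nat \<Rightarrow> complex set" where
  "Omega_star m = {w. w \<noteq> 0 \<and> w ^ m \<in> Delta}"

definition gevrey1 :: "nat \<Rightarrow> (nat \<Rightarrow> complex) \<Rightarrow> bool" where
  "gevrey1 m a \<longleftrightarrow> (\<exists>C K. \<forall>n. norm (a n) \<le> C * K ^ n * Gamma (1 + real n / real m))"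

definition hfun :: "complex \<Rightarrow> complex" where
  "hfun \<xi> = (if \<xi> = 0 then 1 else \<xi> / (1 - exp (- \<xi>)))"

definition gfun :: "(nat \<Rightarrow> complex) \<Rightarrow> nat \<Rightarrow> nat \<Rightarrow> complex \<Rightarrow> complex" where
  "gfun a m l \<xi> = hfun \<xi> powr (of_nat l / of_nat m - 1) *
     (\<Sum>k. a (l + m * k) * \<xi> ^ k / Gamma (of_nat l / of_nat m + of_nat k))"

text \<open>d_(l+mj) = j-th Taylor coefficient of u \<mapsto> g_l(-ln(1-u)) at u = 0,
  i.e. the coefficient of (1-s)^j in g_l(-ln s).\<close>
definition dcoef :: "(nat \<Rightarrow> complex) \<Rightarrow> nat \<Rightarrow> nat \<Rightarrow> complex" where
  "dcoef a m n = (let l = (n - 1) mod m + 1; j = (n - 1) div m in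
     (deriv ^^ j) (\<lambda>u. gfun a m l (- Ln (1 - u))) 0 / fact j)"

end

theory Submission
  imports Defs "HOL-Complex_Analysis.Complex_Analysis"
begin

text \<open>
  In the coordinate \<open>v = (1 - e\<^sup>-\<^sup>\<zeta>)\<^bsup>1/m\<^esup>\<close> the domain becomes the unit disc,
  uniformly over the \<open>m\<close> sheets: with \<open>h u = - Ln (1 - u) / u\<close>, whose real part is at least
  \<open>1/2\<close> on the disc, the map \<open>v \<mapsto> v h(v\<^sup>m)\<^bsup>1/m\<^esup>\<close> sends the punctured disc into
  \<open>Omega_star m\<close>. Pulling the Borel transform back along it and multiplying by \<open>v\<^bsup>m-1\<^esup>\<close> gives
  one function \<open>\<Psi>\<close>, holomorphic on the whole disc, and splitting its germ at \<open>0\<close> by residues of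
  exponents modulo \<open>m\<close> shows that its Taylor coefficients are exactly \<open>d\<^sub>1, d\<^sub>2, \<dots>\<close>.

  The exponential bound becomes \<open>|\<Psi> v| \<le> C |1 - v\<^sup>m|\<^bsup>-b\<^esup>\<close> for every \<open>b > max B 1\<close>, and the Cauchy
  integral over the circle of radius \<open>1 - 1/(n+2)\<close> yields \<open>d\<^sub>n = O(n\<^bsup>b-1\<^esup>)\<close>. The factor multiplying
  \<open>d\<^sub>n\<close> is \<open>Beta (n/m) z = O(n\<^bsup>-Re z\<^esup>)\<close>, the Laplace transform of
  \<open>(1 - e\<^sup>-\<^sup>t)\<^bsup>n/m-1\<^esup>\<close>; this gives absolute convergence and justifies integrating
  the expansion term by term.
\<close>

section \<open>The Beta function as a Laplace transform\<close>

text \<open>Fubini for counting measure against Lebesgue measure. Extending each \<open>f n\<close>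
  by zero outside \<open>S\<close> brings the Lebesgue theorems on the whole line into play; for
  absolutely integrable functions the Lebesgue and gauge integrals agree, which leads back to
  \<open>integral S\<close>.\<close>

lemma
  fixes f :: "nat \<Rightarrow> real \<Rightarrow> complex"
  assumes int: "\<And>n. f n absolutely_integrable_on S"
    and sm: "\<And>x. x \<in> S \<Longrightarrow> summable (\<lambda>n. norm (f n x))"
    and smi: "summable (\<lambda>n. integral S (\<lambda>x. norm (f n x)))"
  shows absolutely_integrable_suminf: "(\<lambda>x. \<Sum>n. f n x) absolutely_integrable_on S"
    and sums_integral_on: "(\<lambda>n. integral S (f n)) sums integral S (\<lambda>x. \<Sum>n. f n x)"
proof -
  let ?f = "\<lambda>n x. indicat_real S x *\<^sub>R f n x"
  have i: "integrable lebesgue (?f n)" for n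
    using int[of n] by (simp add: set_integrable_def)
  have sm': "summable (\<lambda>n. norm (?f n x))" for x
    using sm[of x] by (cases "x \<in> S") auto
  have norm_int: "(\<lambda>x. norm (f n x)) absolutely_integrable_on S" for n
    using absolutely_integrable_norm[OF int[of n]] by (simp add: o_def)
  have eq: "(\<integral>x. norm (?f n x) \<partial>lebesgue) = integral S (\<lambda>x. norm (f n x))" for n
    using set_lebesgue_integral_eq_integral(2)[OF norm_int[of n]]
    by (simp add: set_lebesgue_integral_def)
  have smi': "summable (\<lambda>n. \<integral>x. norm (?f n x) \<partial>lebesgue)"
    unfolding eq by (rule smi)
  have su: "(\<Sum>n. ?f n x) = indicat_real S x *\<^sub>R (\<Sum>n. f n x)" for x
    by (cases "x \<in> S") auto
  have "integrable lebesgue (\<lambda>x. \<Sum>n. ?f n x)"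
    by (intro integrable_suminf AE_I2 i sm' smi')
  then show A: "(\<lambda>x. \<Sum>n. f n x) absolutely_integrable_on S"
    by (simp add: su set_integrable_def)
  have "(\<lambda>n. integral\<^sup>L lebesgue (?f n)) sums (\<integral>x. (\<Sum>n. ?f n x) \<partial>lebesgue)"
    by (intro sums_integral AE_I2 i sm' smi')
  moreover have "integral\<^sup>L lebesgue (?f n) = integral S (f n)" for n
    using set_lebesgue_integral_eq_integral(2)[OF int[of n]]
    by (simp add: set_lebesgue_integral_def)
  moreover have "(\<integral>x. (\<Sum>n. ?f n x) \<partial>lebesgue) = integral S (\<lambda>x. \<Sum>n. f n x)"
    using set_lebesgue_integral_eq_integral(2)[OF A]
    by (simp add: set_lebesgue_integral_def su)
  ultimately show "(\<lambda>n. integral S (f n)) sums integral S (\<lambda>x. \<Sum>n. f n x)" by simp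
qed

section \<open>Real and complex Laplace integrals for Beta\<close>

text \<open>Substitution \<open>u = 1 - exp (-t)\<close> in Euler's integral over (0, 1); the
  Jacobian \<open>exp (-t)\<close> raises the exponent \<open>x - 1\<close> of \<open>1 - u\<close>
  to \<open>x\<close>.\<close>

lemma Beta_laplace_real:
  fixes a x :: real
  assumes "a > 0" "x > 0"
  shows "((\<lambda>t. (1 - exp (-t)) powr (a - 1) * exp (- x * t)) has_integral Beta a x) {0<..}"
proof -
  let ?g = "\<lambda>t::real. 1 - exp (-t)"
  let ?f = "\<lambda>u::real. u powr (a - 1) * (1 - u) powr (x - 1)"
  have img: "?g ` {0<..} = {0<..<1}"
  proof (intro equalityI subsetI)
    fix u :: real assume "u \<in> {0<..<1}"
    then have "u = ?g (- ln (1 - u))" "- ln (1 - u) \<in> {0<..}" by auto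
    then show "u \<in> ?g ` {0<..}" by blast
  qed auto
  have B: "(?f has_integral Beta a x) {0<..<1}"
    using has_integral_Beta_real[OF assms] by (simp add: has_integral_Icc_iff_Ioo)
  have "?f absolutely_integrable_on {0<..<1} \<and> integral {0<..<1} ?f = Beta a x"
    using B by (auto intro!: nonnegative_absolutely_integrable_1 integral_unique simp: has_integral_integrable)
  then have "(\<lambda>t. \<bar>exp (-t)\<bar> * ?f (?g t)) absolutely_integrable_on {0<..} \<and>
      integral {0<..} (\<lambda>t. \<bar>exp (-t)\<bar> * ?f (?g t)) = Beta a x"
    unfolding img[symmetric]
    by (subst has_absolute_integral_change_of_variables_1')
       (auto intro!: derivative_eq_intros simp: inj_on_def)
  then have "((\<lambda>t. \<bar>exp (-t)\<bar> * ?f (?g t)) has_integral Beta a x) {0<..}"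
    using set_lebesgue_integral_eq_integral(1) has_integral_iff by blast
  then show ?thesis
  proof (rule has_integral_eq[rotated])
    fix t :: real
    have "exp (-t) * exp (-t) powr (x - 1) = exp (- x * t)"
      by (simp add: powr_def flip: exp_add) (simp add: algebra_simps)
    then show "\<bar>exp (-t)\<bar> * ?f (?g t) = (1 - exp (-t)) powr (a - 1) * exp (- x * t)"
      by (simp add: mult_ac)
  qed
qed

lemma Beta_laplace_absolutely_integrable:
  fixes a :: real and z :: complex
  assumes "a > 0" "Re z > 0"
  shows "(\<lambda>t. of_real ((1 - exp (-t)) powr (a - 1)) * exp (- z * of_real t)) absolutely_integrable_on {0<..}"
proof (rule measurable_bounded_by_integrable_imp_absolutely_integrable)
  show "(\<lambda>t. of_real ((1 - exp (-t)) powr (a - 1)) * exp (- z * of_real t))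
          \<in> borel_measurable (lebesgue_on {0<..})"
    by (intro continuous_imp_measurable_on_sets_lebesgue continuous_intros) auto
  show "(\<lambda>t. (1 - exp (-t)) powr (a - 1) * exp (- Re z * t)) integrable_on {0<..}"
    using Beta_laplace_real[OF assms] by (rule has_integral_integrable)
qed (auto simp: norm_mult)

lemma norm_Beta_laplace_integrand:
  "norm (complex_of_real ((1 - exp (-t)) powr (a - 1)) * exp (- z * of_real t)) =
    (1 - exp (-t)) powr (a - 1) * exp (- Re z * t)"
  by (simp add: norm_mult)

text \<open>Expanding \<open>e\<^bsup>-zt\<^esup>\<close> around a large real point \<open>x0\<close> shows that the integral is holomorphic on
  the disc of radius \<open>x0\<close> about \<open>x0\<close>, which contains \<open>z\<close>; the identity theorem then extends the
  real Beta integral.\<close>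
lemma Beta_laplace_complex:
  fixes a :: real and z :: complex
  assumes a: "a > 0" and z: "Re z > 0"
  shows "integral {0<..} (\<lambda>t. of_real ((1 - exp (-t)) powr (a - 1)) * exp (- z * of_real t)) = Beta (of_real a) z"
proof -
  define g where "g = (\<lambda>t::real. (1 - exp (-t)) powr (a - 1))"
  define J where "J = (\<lambda>z::complex. integral {0<..} (\<lambda>t. of_real (g t) * exp (- z * of_real t)))"
  \<comment> \<open>The disc of radius \<open>x0\<close> about \<open>x0\<close> contains
    \<open>z\<close> as soon as \<open>x0\<close> exceeds
    \<open>(norm z)\<^sup>2 / (2 * Re z)\<close>; twice that value is taken.\<close>
  define x0 where "x0 = (norm z)\<^sup>2 / Re z"
  have g0: "g t \<ge> 0" for t by (simp add: g_def)
  have gc: "continuous_on {0<..} g"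
    unfolding g_def by (intro continuous_intros) auto
  have zn: "norm z > 0" using z by auto
  have x0: "x0 > 0" using z zn by (auto simp: x0_def)
  have zin: "z \<in> ball (of_real x0) x0"
  proof -
    have "(norm (of_real x0 - z))\<^sup>2 = x0\<^sup>2 - 2 * x0 * Re z + (norm z)\<^sup>2"
      unfolding cmod_power2 by (simp add: power2_eq_square algebra_simps)
    also have "\<dots> = x0\<^sup>2 - (norm z)\<^sup>2"
      using z by (simp add: x0_def)
    also have "\<dots> < x0\<^sup>2" using zn by simp
    finally show ?thesis using x0 by (simp add: dist_norm power2_less_imp_less)
  qed
  define c where "c = (\<lambda>k. integral {0<..} (\<lambda>t. of_real (g t) * exp (- of_real x0 * of_real t) * (of_real t ^ k / fact k)) :: complex)"
  have ser: "(\<lambda>k. (-1) ^ k * c k * (s - of_real x0) ^ k) sums J s" if s: "s \<in> ball (of_real x0) x0" for s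
  proof -
    define y where "y = of_real x0 - s"
    define f where "f = (\<lambda>k t. of_real (g t) * exp (- of_real x0 * of_real t) * ((y * of_real t) ^ k / fact k))"
    \<comment> \<open>The norms of the terms add up to \<open>G\<close>, the integrand of the real
      Beta integral at \<open>x0 - norm y > 0\<close>; this one majorant controls all partial
      sums.\<close>
    define G where "G = (\<lambda>t. g t * exp (- (x0 - norm y) * t))"
    have y: "norm y < x0" using s by (simp add: y_def dist_norm)
    have nf: "norm (f k t) = g t * exp (- x0 * t) * ((norm y * t) ^ k / fact k)" if "t > 0" for k t
      using that g0[of t] by (simp add: f_def norm_mult norm_divide norm_power)
    have nsums: "(\<lambda>k. norm (f k t)) sums G t" if "t > 0" for t
    proof -
      have "(\<lambda>k. (norm y * t) ^ k / fact k) sums exp (norm y * t)"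
        using exp_converges[of "norm y * t"] by (simp add: field_simps)
      from sums_mult[OF this, of "g t * exp (- x0 * t)"] show ?thesis
        using that by (simp add: nf G_def algebra_simps flip: exp_add)
    qed
    have Gi: "G integrable_on {0<..}"
      using Beta_laplace_real[of a "x0 - norm y"] a y
      by (auto simp: G_def g_def dest: has_integral_integrable)
    have fi: "f k absolutely_integrable_on {0<..}" for k
    proof (rule measurable_bounded_by_integrable_imp_absolutely_integrable)
      show "f k \<in> borel_measurable (lebesgue_on {0<..})"
        unfolding f_def by (intro continuous_imp_measurable_on_sets_lebesgue continuous_intros gc) auto
      show "norm (f k t) \<le> G t" if "t \<in> {0<..}" for t
      proof -
        have "(\<Sum>i\<in>{k}. norm (f i t)) \<le> (\<Sum>i. norm (f i t))"
          by (rule sum_le_suminf) (use nsums[of t] that in \<open>auto simp: sums_iff\<close>)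
        then show ?thesis using nsums[of t] that by (simp add: sums_iff)
      qed
    qed (use Gi in auto)
    have nfi: "(\<lambda>t. norm (f k t)) integrable_on {0<..}" for k
      using set_lebesgue_integral_eq_integral(1)[OF absolutely_integrable_norm[OF fi[of k]]] by (simp add: o_def)
    have smi: "summable (\<lambda>k. integral {0<..} (\<lambda>t. norm (f k t)))"
    proof (rule summableI_nonneg_bounded)
      show "0 \<le> integral {0<..} (\<lambda>t. norm (f k t))" for k
        by (intro integral_nonneg nfi) auto
      fix n
      have "(\<Sum>k<n. integral {0<..} (\<lambda>t. norm (f k t))) = integral {0<..} (\<lambda>t. \<Sum>k<n. norm (f k t))"
        by (subst integral_sum) (auto intro: nfi)
      also have "\<dots> \<le> integral {0<..} G"
      proof (rule integral_le)
        show "(\<Sum>k<n. norm (f k t)) \<le> G t" if "t \<in> {0<..}" for t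
          using sum_le_suminf[of "\<lambda>k. norm (f k t)" "{..<n}"] nsums[of t] that by (simp add: sums_iff)
      qed (auto intro!: integrable_sum nfi Gi)
      finally show "(\<Sum>k<n. integral {0<..} (\<lambda>t. norm (f k t))) \<le> integral {0<..} G" .
    qed
    have "(\<lambda>k. integral {0<..} (f k)) sums integral {0<..} (\<lambda>t. \<Sum>k. f k t)"
      by (rule sums_integral_on) (use fi smi nsums in \<open>auto simp: sums_iff\<close>)
    moreover have "integral {0<..} (f k) = (-1) ^ k * c k * (s - of_real x0) ^ k" for k
    proof -
      have "f k = (\<lambda>t. y ^ k * (of_real (g t) * exp (- of_real x0 * of_real t) * (of_real t ^ k / fact k)))"
        by (simp add: f_def power_mult_distrib fun_eq_iff)
      then have "integral {0<..} (f k) = y ^ k * c k"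
        unfolding c_def by (simp only: integral_mult_right)
      also have "y ^ k = (-1) ^ k * (s - of_real x0) ^ k"
        by (simp add: y_def flip: power_mult_distrib)
      finally show ?thesis by simp
    qed
    moreover have "integral {0<..} (\<lambda>t. \<Sum>k. f k t) = J s"
      unfolding J_def
    proof (rule integral_cong)
      fix t :: real
      have "(\<lambda>k. (y * of_real t) ^ k / fact k) sums exp (y * of_real t)"
        using exp_converges[of "y * of_real t"] by (simp add: scaleR_conv_of_real field_simps)
      from sums_mult[OF this, of "of_real (g t) * exp (- of_real x0 * of_real t)"]
      have "(\<lambda>k. f k t) sums (of_real (g t) * exp (- of_real x0 * of_real t) * exp (y * of_real t))"
        by (simp add: f_def)
      also have "of_real (g t) * exp (- of_real x0 * of_real t) * exp (y * of_real t) =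
          of_real (g t) * exp (- s * of_real t)"
        by (simp add: mult.assoc y_def algebra_simps flip: exp_add)
      finally show "(\<Sum>k. f k t) = of_real (g t) * exp (- s * of_real t)" by (simp add: sums_iff)
    qed
    ultimately show ?thesis by simp
  qed
  have Jhol: "J holomorphic_on ball (of_real x0) x0"
    by (rule power_series_holomorphic) (rule ser)
  have pos: "Re s > 0" if "s \<in> ball (of_real x0) x0" for s
    using abs_Re_le_cmod[of "of_real x0 - s"] that by (simp add: dist_norm)
  have nonint: "s \<notin> \<int>\<^sub>\<le>\<^sub>0" if "Re s > 0" for s :: complex
    using that by (auto elim!: nonpos_Ints_cases)
  have Bhol: "(\<lambda>s. Beta (of_real a) s) holomorphic_on ball (of_real x0) x0"
    unfolding Beta_def
    by (intro holomorphic_intros) (use pos a nonint in \<open>force simp: Gamma_eq_zero_iff\<close>)+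
  have "J z - Beta (of_real a) z = 0"
  proof (rule analytic_continuation[where f = "\<lambda>s. J s - Beta (of_real a) s" and \<xi> = "of_real x0"
      and S = "ball (of_real x0) x0" and U = "of_real ` {0<..<2 * x0}"])
    show "(\<lambda>s. J s - Beta (of_real a) s) holomorphic_on ball (of_real x0) x0"
      by (intro holomorphic_intros Jhol Bhol)
    show "of_real x0 islimpt complex_of_real ` {0<..<2 * x0}"
      unfolding islimpt_approachable
    proof safe
      fix e :: real assume e: "e > 0"
      define h where "h = min e x0 / 2"
      have h: "h > 0" "h < e" "h < x0" using e x0 by (auto simp: h_def)
      show "\<exists>x'\<in>complex_of_real ` {0<..<2 * x0}. x' \<noteq> of_real x0 \<and> dist x' (of_real x0) < e"
      proof (rule bexI[of _ "of_real (x0 + h)"])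
        show "complex_of_real (x0 + h) \<in> complex_of_real ` {0<..<2 * x0}"
          using h by (intro imageI) auto
      qed (use h in \<open>auto simp: dist_norm\<close>)
    qed
    show "complex_of_real ` {0<..<2 * x0} \<subseteq> ball (of_real x0) x0"
      by (auto simp: dist_norm simp flip: of_real_diff)
    fix s assume "s \<in> complex_of_real ` {0<..<2 * x0}"
    then obtain x where x: "s = of_real x" "x > 0" by auto
    have "J s = integral {0<..} (\<lambda>t. of_real (g t * exp (- x * t)))"
      unfolding J_def x(1) by (intro integral_cong) (simp add: exp_of_real flip: of_real_mult of_real_minus)
    also have "\<dots> = of_real (Beta a x)"
      using has_integral_of_real[OF Beta_laplace_real[OF a x(2)], where 'b = complex]
      unfolding g_def by (intro integral_unique) (simp add: o_def)
    finally show "J s - Beta (of_real a) s = 0" by (simp add: x Beta_complex_of_real)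
  qed (use x0 zin in \<open>auto simp: dist_norm\<close>)
  then show ?thesis by (simp add: J_def g_def)
qed

section \<open>Size of Beta values\<close>

lemma Beta_real_nonneg:
  fixes a x :: real
  assumes "a > 0" "x > 0"
  shows "Beta a x \<ge> 0"
  using assms by (auto simp: Beta_def intro!: divide_nonneg_nonneg mult_nonneg_nonneg
      less_imp_le[OF Gamma_real_pos] add_pos_pos)

text \<open>Triangle inequality under the Laplace integral, since \<open>exp (- z * t)\<close> has
  modulus \<open>exp (- Re z * t)\<close>.\<close>

lemma norm_Beta_le:
  fixes a :: real and z :: complex
  assumes "a > 0" "Re z > 0"
  shows "norm (Beta (of_real a) z) \<le> Beta a (Re z)"
proof -
  note B = Beta_laplace_real[OF assms]
  have "norm (Beta (of_real a) z) \<le> integral {0<..} (\<lambda>t. (1 - exp (-t)) powr (a - 1) * exp (- Re z * t))"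
    unfolding Beta_laplace_complex[OF assms, symmetric]
    by (rule integral_norm_bound_integral)
       (use Beta_laplace_absolutely_integrable[OF assms] B norm_Beta_laplace_integrand
         in \<open>auto simp: set_lebesgue_integral_eq_integral(1) has_integral_integrable norm_mult\<close>)
  then show ?thesis using integral_unique[OF B] by simp
qed

text \<open>At integers, \<open>Beta j x * j powr x\<close> is the convergent, hence bounded,
  sequence \<open>Gamma_series' x j\<close>. As Beta decreases in its first argument,
  \<open>n / m\<close> may be rounded down to an integer, or to \<open>1 / m\<close> when
  \<open>n < m\<close>.\<close>

lemma Beta_powr_bound:
  fixes x :: real
  assumes x: "x > 0" and m: "m \<ge> (1::nat)"
  obtains K where "K \<ge> 0" "\<And>n. n \<ge> 1 \<Longrightarrow> Beta (real n / real m) x \<le> K * real n powr (- x)"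
proof -
  have "Bseq (Gamma_series' x)"
    using Gamma_series'_LIMSEQ[of x] by (intro convergent_imp_Bseq) (auto simp: convergent_def)
  then obtain K1 where K1: "K1 > 0" "\<And>j. \<bar>Gamma_series' x j\<bar> \<le> K1"
    by (auto simp: Bseq_def)
  have x': "x \<notin> \<int>\<^sub>\<le>\<^sub>0" using x by (auto elim!: nonpos_Ints_cases)
  have B1: "Beta (real j) x \<le> K1 * real j powr (- x)" if "j \<ge> 1" for j
  proof -
    have "Gamma (real j) = fact (j - 1)"
      using Gamma_fact[of "j - 1", where 'a = real] that by (simp add: of_nat_diff)
    then have "Beta (real j) x = Gamma_series' x j * real j powr (- x)"
      using that x x' by (simp add: Beta_def Gamma_series'_def pochhammer_Gamma powr_def exp_minus field_simps Gamma_eq_zero_iff)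
    also have "\<dots> \<le> K1 * real j powr (- x)"
      using K1(2)[of j] by (intro mult_right_mono) auto
    finally show ?thesis .
  qed
  define K where "K = max (K1 * (2 * real m) powr x) (Beta (1 / real m) x * real m powr x)"
  have "Beta (real n / real m) x \<le> K * real n powr (- x)" if n: "n \<ge> 1" for n
  proof (cases "n < m")
    case True
    have "Beta (real n / real m) x \<le> Beta (1 / real m) x * 1"
      using n x m by (auto intro!: Beta_real_mono simp: field_simps)
    also have "\<dots> \<le> Beta (1 / real m) x * (real m powr x * real n powr (- x))"
    proof (intro mult_left_mono)
      have "real n powr x \<le> real m powr x" using True x by (intro powr_mono2) auto
      then show "1 \<le> real m powr x * real n powr (- x)" using n by (simp add: powr_minus field_simps)
      show "0 \<le> Beta (1 / real m) x" 
        using m x by (intro Beta_real_nonneg) auto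
    qed
    also have "\<dots> \<le> K * real n powr (- x)"
      unfolding mult.assoc[symmetric] K_def by (intro mult_right_mono) auto
    finally show ?thesis .
  next
    case False
    \<comment> \<open>Rounding down loses at most a factor 2, so \<open>j \<ge> n / (2 * m)\<close>;
      passing from powers of \<open>j\<close> to powers of \<open>n\<close> costs the factor
      \<open>(2 * real m) powr x\<close> in \<open>K\<close>.\<close>
    define j where "j = n div m"
    have j: "j \<ge> 1" using False m by (simp add: j_def div_greater_zero_iff Suc_le_eq)
    have "n = m * j + n mod m" by (simp add: j_def)
    moreover have "m \<le> m * j" "n mod m < m" using j m by auto
    ultimately have jn: "m * j \<le> n" "n \<le> 2 * m * j" by linarith+
    have "real (m * j) \<le> real n" using jn(1) by (rule of_nat_mono)
    then have "Beta (real n / real m) x \<le> Beta (real j) x"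
      using j x m by (intro Beta_real_mono) (auto simp: field_simps)
    also have "\<dots> \<le> K1 * real j powr (- x)" by (rule B1[OF j])
    also have "\<dots> \<le> K1 * ((2 * real m) powr x * real n powr (- x))"
    proof (intro mult_left_mono)
      have "real n \<le> real (2 * m * j)" using jn(2) by (rule of_nat_mono)
      then have "real n powr x \<le> (2 * real m * real j) powr x"
        using x by (intro powr_mono2) auto
      also have "\<dots> = (2 * real m) powr x * real j powr x" by (rule powr_mult) 
      finally show "real j powr (- x) \<le> (2 * real m) powr x * real n powr (- x)"
        using n j by (simp add: powr_minus field_simps)
    qed (use K1 in auto)
    also have "\<dots> \<le> K * real n powr (- x)"
      unfolding mult.assoc[symmetric] K_def by (intro mult_right_mono) auto
    finally show ?thesis .
  qed
  moreover have "K \<ge> 0" using K1 by (simp add: K_def le_max_iff_disj)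
  ultimately show ?thesis using that by blast
qed

section \<open>Taylor coefficients of functions with a power singularity on the circle\<close>

lemma sin_ge_half:
  fixes y :: real
  assumes "0 \<le> y" "y \<le> pi / 2"
  shows "sin y \<ge> y / 2"
proof -
  have "\<bar>sin y - y\<bar> \<le> y ^ 3 / 6"
    using Maclaurin_sin_bound[of y 3] assms by (simp add: eval_nat_numeral sin_coeff_def)
  moreover have "y ^ 3 / 6 \<le> y / 2"
  proof -
    have "y \<le> 16 / 10" using assms pi_approx by simp
    then have "y * y \<le> (16 / 10) * (16 / 10)" using assms by (intro mult_mono) auto
    then have "y * y \<le> 3" by simp
    then have "y * (y * y) \<le> y * 3" using assms by (intro mult_left_mono) auto
    then show ?thesis by (simp add: eval_nat_numeral)
  qed
  ultimately show ?thesis by linarith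
qed

text \<open>Average of two lower bounds for the distance \<open>N\<close>: the radial gap
  \<open>1 - \<rho>\<close> and the distance of \<open>x\<close> from the nearest integer. The
  second comes from the chord \<open>norm (e - 1) = 2 * \<bar>sin (pi * x)\<bar>\<close>, which is
  at most \<open>N + (1 - \<rho>) \<le> 2 * N\<close>.\<close>

lemma norm_one_minus_circle_ge:
  fixes \<rho> x :: real
  assumes \<rho>: "0 \<le> \<rho>" "\<rho> < 1" and x: "0 \<le> x" "x \<le> 1"
  shows "norm (1 - of_real \<rho> * exp (2 * pi * \<i> * x)) \<ge> (1 - \<rho> + min x (1 - x)) / 2"
proof -
  define e where "e = exp (2 * pi * \<i> * x)"
  define N where "N = norm (1 - of_real \<rho> * e)"
  have e1: "norm e = 1" by (simp add: e_def)
  have "1 - \<rho> \<le> N"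
    using norm_triangle_ineq2[of 1 "of_real \<rho> * e"] \<rho> by (simp add: N_def norm_mult e1)
  moreover have "min x (1 - x) \<le> N"
  proof -
    have "norm (e - 1) \<le> N + (1 - \<rho>)"
    proof -
      have "e - 1 = - (1 - of_real \<rho> * e) + of_real (1 - \<rho>) * e" by (simp add: algebra_simps)
      also have "norm \<dots> \<le> norm (- (1 - of_real \<rho> * e)) + norm (of_real (1 - \<rho>) * e)"
        by (rule norm_triangle_ineq)
      also have "norm (of_real (1 - \<rho>) * e) = 1 - \<rho>" using \<rho> unfolding norm_mult e1 norm_of_real by simp
      finally show ?thesis unfolding N_def norm_minus_cancel .
    qed
    also have "\<dots> \<le> 2 * N" using \<open>1 - \<rho> \<le> N\<close> by simp
    finally have "norm (e - 1) \<le> 2 * N" .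
    moreover have "norm (e - 1) = 2 * \<bar>sin (pi * x)\<bar>"
      using dist_exp_i_1[of "2 * pi * x"] by (simp add: e_def mult_ac)
    moreover have "\<bar>sin (pi * x)\<bar> \<ge> min x (1 - x)"
    proof (cases "x \<le> 1 / 2")
      case True
      have "sin (pi * x) \<ge> pi * x / 2" using True x by (intro sin_ge_half) auto
      moreover have "pi * x / 2 \<ge> x" using pi_gt3 x mult_right_mono[of 2 pi x] by simp
      ultimately show ?thesis by linarith
    next
      case False
      have "sin (pi * x) = sin (pi * (1 - x))" by (simp add: algebra_simps sin_diff)
      moreover have "sin (pi * (1 - x)) \<ge> pi * (1 - x) / 2" using False x by (intro sin_ge_half) auto
      moreover have "pi * (1 - x) / 2 \<ge> 1 - x" using pi_gt3 x mult_right_mono[of 2 pi "1 - x"] by simp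
      ultimately show ?thesis by linarith
    qed
    ultimately show ?thesis by linarith
  qed
  ultimately have "(1 - \<rho> + min x (1 - x)) / 2 \<le> (N + N) / 2"
    by (intro divide_right_mono add_mono) auto
  then show ?thesis by (simp add: N_def e_def)
qed

lemma integral_shifted_powr_le:
  fixes \<delta> b :: real
  assumes "\<delta> > 0" "b > 1"
  shows "integral {0..1} (\<lambda>x. (\<delta> + x) powr (-b)) \<le> \<delta> powr (1 - b) / (b - 1)"
    and "integral {0..1} (\<lambda>x. (\<delta> + (1 - x)) powr (-b)) \<le> \<delta> powr (1 - b) / (b - 1)"
proof -
  have 1: "((\<lambda>x. (\<delta> + x) powr (-b)) has_integral
      ((\<delta> + 1) powr (1 - b) / (1 - b) - (\<delta> + 0) powr (1 - b) / (1 - b))) {0..1}"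
    using assms
    by (intro fundamental_theorem_of_calculus)
       (auto intro!: derivative_eq_intros simp: has_real_derivative_iff_has_vector_derivative[symmetric])
  have 2: "((\<lambda>x. (\<delta> + (1 - x)) powr (-b)) has_integral
      (- ((\<delta> + (1 - 1)) powr (1 - b) / (1 - b)) - (- ((\<delta> + (1 - 0)) powr (1 - b) / (1 - b))))) {0..1}"
    using assms
    by (intro fundamental_theorem_of_calculus)
       (auto intro!: derivative_eq_intros simp: has_real_derivative_iff_has_vector_derivative[symmetric])
  have eq: "(\<delta> + 1) powr (1 - b) / (1 - b) - \<delta> powr (1 - b) / (1 - b) =
      \<delta> powr (1 - b) / (b - 1) - (\<delta> + 1) powr (1 - b) / (b - 1)"
    using assms by (simp add: divide_simps) (simp add: algebra_simps)
  \<comment> \<open>The endpoint away from the singularity contributes with a minus sign and is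
    dropped.\<close>
  have "(\<delta> + 1) powr (1 - b) / (b - 1) \<ge> 0" using assms by simp
  with eq show "integral {0..1} (\<lambda>x. (\<delta> + x) powr (-b)) \<le> \<delta> powr (1 - b) / (b - 1)"
    "integral {0..1} (\<lambda>x. (\<delta> + (1 - x)) powr (-b)) \<le> \<delta> powr (1 - b) / (b - 1)"
    using integral_unique[OF 1] integral_unique[OF 2] by auto
qed

text \<open>Angle 0, where the kernel peaks, is approached from both ends of \<open>{0..1}\<close>,
  so one one-sided kernel per end dominates. Integration gains one power over the pointwise bound:
  \<open>1 - b\<close> in place of \<open>-b\<close>.\<close>

lemma circle_mean_powr_le:
  fixes \<rho> b :: real
  assumes \<rho>: "0 \<le> \<rho>" "\<rho> < 1" and b: "b > 1"
  shows "integral {0..1} (\<lambda>x. norm (1 - of_real \<rho> * exp (2 * pi * \<i> * of_real x)) powr (-b))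
     \<le> 2 powr b * 2 / (b - 1) * (1 - \<rho>) powr (1 - b)"
proof -
  define \<delta> where "\<delta> = 1 - \<rho>"
  have \<delta>: "\<delta> > 0" using \<rho> by (simp add: \<delta>_def)
  let ?f = "\<lambda>x. norm (1 - of_real \<rho> * exp (2 * pi * \<i> * of_real x)) powr (-b)"
  let ?g1 = "\<lambda>x. (\<delta> + x) powr (-b)" and ?g2 = "\<lambda>x. (\<delta> + (1 - x)) powr (-b)"
  have le: "(\<delta> + min x (1 - x)) / 2 \<le> norm (1 - of_real \<rho> * exp (2 * pi * \<i> * of_real x))"
    if "x \<in> {0..1}" for x
    using norm_one_minus_circle_ge[OF \<rho>, of x] that by (simp add: \<delta>_def)
  have pos: "norm (1 - of_real \<rho> * exp (2 * pi * \<i> * of_real x)) > 0" if "x \<in> {0..1}" for x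
    using le[OF that] \<delta> that by (smt (verit) atLeastAtMost_iff half_gt_zero)
  have i1: "?g1 integrable_on {0..1}" and i2: "?g2 integrable_on {0..1}"
    using \<delta> by (auto intro!: integrable_continuous_real continuous_intros)
  have "integral {0..1} ?f \<le> integral {0..1} (\<lambda>x. 2 powr b * (?g1 x + ?g2 x))"
  proof (rule integral_le)
    show "?f integrable_on {0..1}"
      using pos by (intro integrable_continuous_real continuous_intros) force+
    show "(\<lambda>x. 2 powr b * (?g1 x + ?g2 x)) integrable_on {0..1}"
      using i1 i2 by (intro integrable_on_mult_right integrable_add) auto
    fix x :: real assume x: "x \<in> {0..1}"
    have "?f x \<le> ((\<delta> + min x (1 - x)) / 2) powr (-b)"
      using le[OF x] \<delta> x b by (intro powr_mono2') auto
    also have "\<dots> = 2 powr b * (\<delta> + min x (1 - x)) powr (-b)"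
      using \<delta> x by (subst powr_divide) (auto simp: powr_minus field_simps)
    also have "\<dots> \<le> 2 powr b * (?g1 x + ?g2 x)"
      by (intro mult_left_mono) (auto simp: min_def)
    finally show "?f x \<le> 2 powr b * (?g1 x + ?g2 x)" .
  qed
  also have "\<dots> = 2 powr b * (integral {0..1} ?g1 + integral {0..1} ?g2)"
    using i1 i2 by (simp add: Henstock_Kurzweil_Integration.integral_add)
  also have "\<dots> \<le> 2 powr b * (\<delta> powr (1 - b) / (b - 1) + \<delta> powr (1 - b) / (b - 1))"
    using integral_shifted_powr_le[OF \<delta> b] by (intro mult_left_mono add_mono) auto
  also have "\<dots> = 2 powr b * 2 / (b - 1) * (1 - \<rho>) powr (1 - b)"
    by (simp add: \<delta>_def)
  finally show ?thesis .
qed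

text \<open>Raising to the power \<open>m\<close> winds a circle \<open>m\<close> times around its
  image; means over the angle are unaffected. This handles a singular factor that depends on
  \<open>v ^ m\<close> only.\<close>

lemma integral_periodic_scale:
  fixes g :: "real \<Rightarrow> real"
  assumes cont: "continuous_on UNIV g" and per: "\<And>x. g (x + 1) = g x" and m: "m \<ge> (1::nat)"
  shows "integral {0..1} (\<lambda>x. g (real m * x)) = integral {0..1} g"
proof -
  have gi: "g integrable_on {a..b}" for a b
    by (intro integrable_continuous_real continuous_on_subset[OF cont]) auto
  have pern: "g (x + real n) = g x" for x n
  proof (induction n)
    case (Suc n)
    have "g (x + real (Suc n)) = g ((x + real n) + 1)" by (simp add: add_ac)
    then show ?case using per Suc by simp
  qed auto
  have "integral {0..real n} g = real n * integral {0..1} g" for n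
  proof (induction n)
    case (Suc n)
    have "((\<lambda>x. g (1 *\<^sub>R x + - real n)) has_integral
        (integral {0..1} g /\<^sub>R 1 ^ DIM(real))) (cbox ((0 - - real n) /\<^sub>R 1) ((1 - - real n) /\<^sub>R 1))"
      by (rule has_integral_affinity') (use gi[of 0 1] in \<open>auto simp: integrable_integral\<close>)
    moreover have "g (1 *\<^sub>R x + - real n) = g x" for x
      using pern[of "x - real n" n] by simp
    ultimately have "(g has_integral integral {0..1} g) {real n..real (Suc n)}"
      by (simp add: add_ac)
    then have "integral {real n..real (Suc n)} g = integral {0..1} g" by (rule integral_unique)
    moreover have "integral {0..real (Suc n)} g = integral {0..real n} g + integral {real n..real (Suc n)} g"
      by (intro Henstock_Kurzweil_Integration.integral_combine[symmetric] gi) auto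
    ultimately show ?case using Suc by (simp add: algebra_simps)
  qed auto
  then have "(g has_integral real m * integral {0..1} g) (cbox 0 (real m))"
    using integrable_integral[OF gi[of 0 "real m"]] by simp
  from has_integral_affinity'[OF this, of "real m" 0] m
  have "((\<lambda>x. g (real m * x)) has_integral integral {0..1} g) {0..1}"
    by (simp add: field_simps)
  then show ?thesis by (rule integral_unique)
qed

section \<open>Cauchy estimate for the Taylor coefficients\<close>

text \<open>Cauchy's formula is estimated by the mean of the singular factor over the circle. Its
  supremum would only give order \<open>b\<close> in \<open>n\<close>, and the lost power would
  shrink the half-plane of convergence by 1.\<close>

lemma taylor_coeff_powr_bound:
  fixes f :: "complex \<Rightarrow> complex"
  assumes hol: "f holomorphic_on ball 0 1" and m: "m \<ge> (1::nat)" and b: "b > 1"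
    and bnd: "\<And>v. norm v < 1 \<Longrightarrow> norm (f v) \<le> C * norm (1 - v ^ m) powr (-b)"
  obtains K where "K \<ge> 0" "\<And>n. norm ((deriv ^^ n) f 0 / fact n) \<le> K * real (Suc n) powr (b - 1)"
proof -
  have C: "C \<ge> 0"
    using bnd[of 0] m by (simp add: power_0_left) (meson norm_ge_zero order_trans)
  define K0 where "K0 = 2 powr b * 2 / (b - 1)"
  have K0: "K0 \<ge> 0" using b by (simp add: K0_def)
  define K where "K = exp 1 * C * K0 * 2 powr (b - 1)"
  have "norm ((deriv ^^ n) f 0 / fact n) \<le> K * real (Suc n) powr (b - 1)" for n
  proof -
    \<comment> \<open>With \<open>1 - r = 1 / (n + 2)\<close> the factor \<open>1 / r ^ n\<close> is
      at most \<open>exp 1\<close>, while \<open>(1 - r) powr (1 - b)\<close> has the desired order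
      \<open>b - 1\<close> in \<open>n\<close>. The shift by 2 keeps \<open>r\<close> positive at
      \<open>n = 0\<close>.\<close>
    define r where "r = 1 - 1 / real (n + 2)"
    have r: "0 < r" "r < 1" by (auto simp: r_def field_simps)
    define \<rho> where "\<rho> = r ^ m"
    have \<rho>: "0 \<le> \<rho>" "\<rho> < 1" "\<rho> \<le> r"
      using r m power_decreasing[of 1 m r] by (auto simp: \<rho>_def power_less_one_iff)
    define g where "g = (\<lambda>x::real. norm (1 - of_real \<rho> * exp (2 * pi * \<i> * of_real x)) powr (-b))"
    have ne: "of_real \<rho> * exp (2 * pi * \<i> * of_real x) \<noteq> 1" for x :: real
    proof
      assume "of_real \<rho> * exp (2 * pi * \<i> * of_real x) = 1"
      then have "norm (of_real \<rho> * exp (2 * pi * \<i> * of_real x)) = 1" by simp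
      then show False using \<rho> by (simp add: norm_mult)
    qed
    have gc: "continuous_on UNIV g"
      unfolding g_def using ne by (intro continuous_intros) (auto simp: eq_commute[of 1])
    have per: "g (x + 1) = g x" for x
      by (simp add: g_def ring_distribs exp_add)
    let ?\<gamma> = "circlepath 0 r"
    have cv: "((\<lambda>u. f u / (u - 0) ^ Suc n) has_contour_integral (2 * pi * \<i>) / fact n * (deriv ^^ n) f 0) ?\<gamma>"
    proof (rule Cauchy_has_contour_integral_higher_derivative_circlepath)
      show "continuous_on (cball 0 r) f"
        using r by (intro holomorphic_on_imp_continuous_on holomorphic_on_subset[OF hol]) auto
      show "f holomorphic_on ball 0 r"
        using r by (intro holomorphic_on_subset[OF hol]) auto
    qed (use r in auto)
    let ?h = "\<lambda>x. f (?\<gamma> x) / ?\<gamma> x ^ Suc n * vector_derivative ?\<gamma> (at x within {0..1})"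
    have hi: "(?h has_integral (2 * pi * \<i>) / fact n * (deriv ^^ n) f 0) {0..1}"
      using cv by (simp add: has_contour_integral_def)
    have circ: "?\<gamma> x = of_real r * exp (2 * pi * \<i> * of_real x)" for x
      by (simp add: circlepath_def part_circlepath_def linepath_def mult_ac scaleR_conv_of_real)
    have hn: "norm (?h x) \<le> 2 * pi * C / r ^ n * g (real m * x)" if x: "x \<in> {0..1}" for x
    proof -
      have nc: "norm (?\<gamma> x) = r" using r by (simp add: circ norm_mult)
      have vd: "norm (vector_derivative ?\<gamma> (at x within {0..1})) = 2 * pi * r"
        using x r by (simp add: vector_derivative_circlepath01 norm_mult)
      have "?\<gamma> x ^ m = of_real \<rho> * exp (2 * pi * \<i> * of_real (real m * x))"
        by (simp add: circ power_mult_distrib \<rho>_def flip: exp_of_nat_mult) (simp add: mult_ac)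
      then have fb: "norm (f (?\<gamma> x)) \<le> C * g (real m * x)"
        using bnd[of "?\<gamma> x"] nc r by (simp add: g_def)
      have "norm (?h x) = norm (f (?\<gamma> x)) * (2 * pi / r ^ n)"
        unfolding norm_mult norm_divide norm_power nc vd using r by (simp add: field_simps)
      also have "\<dots> \<le> C * g (real m * x) * (2 * pi / r ^ n)"
        using fb r by (intro mult_right_mono) auto
      finally show ?thesis by (simp add: field_simps)
    qed
    have "norm (integral {0..1} ?h) \<le> integral {0..1} (\<lambda>x. 2 * pi * C / r ^ n * g (real m * x))"
    proof (rule integral_norm_bound_integral)
      show "?h integrable_on {0..1}" using hi by (rule has_integral_integrable)
      show "(\<lambda>x. 2 * pi * C / r ^ n * g (real m * x)) integrable_on {0..1}"
        by (intro integrable_continuous_real continuous_intros continuous_on_compose2[OF gc]) auto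
    qed (use hn in auto)
    also have "\<dots> = 2 * pi * C / r ^ n * integral {0..1} g"
      using integral_periodic_scale[OF gc per m] by simp
    also have "\<dots> \<le> 2 * pi * C / r ^ n * (K0 * (1 - \<rho>) powr (1 - b))"
      using circle_mean_powr_le[OF \<rho>(1,2) b] C r
      by (intro mult_left_mono) (auto simp: g_def K0_def)
    \<comment> \<open>Here \<open>\<rho> = r ^ m \<le> r\<close> gives
      \<open>1 - r \<le> 1 - \<rho>\<close>, and the exponent \<open>1 - b\<close> is
      negative.\<close>
    also have "\<dots> \<le> 2 * pi * C / r ^ n * (K0 * (1 - r) powr (1 - b))"
      using \<rho> r b C K0 by (intro mult_left_mono powr_mono2') auto
    also have "integral {0..1} ?h = 2 * pi * \<i> * ((deriv ^^ n) f 0 / fact n)"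
      using integral_unique[OF hi] by simp
    finally have "2 * pi * norm ((deriv ^^ n) f 0 / fact n) \<le> 2 * pi * (C / r ^ n * (K0 * (1 - r) powr (1 - b)))"
      unfolding norm_mult by (simp add: mult.assoc)
    then have A: "norm ((deriv ^^ n) f 0 / fact n) \<le> C * (1 / r ^ n) * (K0 * (1 - r) powr (1 - b))"
      by (subst (asm) mult_le_cancel_left_pos) (auto simp: pi_gt_zero)
    have rn: "1 / r ^ n \<le> exp 1"
    proof -
      have "1 / r = 1 + 1 / real (n + 1)" by (simp add: r_def field_simps)
      also have "\<dots> \<le> exp (1 / real (n + 1))" by (rule exp_ge_add_one_self)
      finally have "(1 / r) ^ n \<le> exp (1 / real (n + 1)) ^ n" using r by (intro power_mono) auto
      also have "\<dots> = exp (real n / real (n + 1))" by (simp flip: exp_of_nat_mult)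
      also have "\<dots> \<le> exp 1" by simp
      finally show ?thesis by (simp add: power_divide)
    qed
    have "(1 - r) powr (1 - b) = real (n + 2) powr (b - 1)"
      by (simp add: r_def powr_divide powr_diff field_simps)
    also have "\<dots> \<le> (2 * real (Suc n)) powr (b - 1)"
      using b by (intro powr_mono2) auto
    also have "\<dots> = 2 powr (b - 1) * real (Suc n) powr (b - 1)"
      by (simp add: powr_mult del: of_nat_Suc)
    finally have Q: "K0 * (1 - r) powr (1 - b) \<le> K0 * (2 powr (b - 1) * real (Suc n) powr (b - 1))"
      using K0 by (intro mult_left_mono) auto
    have "C * (1 / r ^ n) * (K0 * (1 - r) powr (1 - b)) \<le>
        C * exp 1 * (K0 * (2 powr (b - 1) * real (Suc n) powr (b - 1)))"
      by (rule mult_mono[OF mult_left_mono[OF rn C] Q]) (use C K0 in auto)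
    with A have "norm ((deriv ^^ n) f 0 / fact n) \<le> C * exp 1 * (K0 * (2 powr (b - 1) * real (Suc n) powr (b - 1)))"
      by (rule order_trans)
    then show ?thesis by (simp add: K_def mult_ac)
  qed
  moreover have "K \<ge> 0" using C K0 by (simp add: K_def)
  ultimately show ?thesis using that by blast
qed

section \<open>From exponential growth to a power singularity\<close>

text \<open>The imaginary part of \<open>Ln s\<close> costs the constant
  \<open>exp (B * pi)\<close>. The real part gives \<open>norm s powr (-B)\<close> inside the unit
  disc and \<open>norm s powr B\<close> outside; the latter is absorbed by
  \<open>2 powr (B + b)\<close> because \<open>norm s \<le> 2\<close>. With
  \<open>s = 1 - v ^ m\<close> this converts the growth hypothesis to the disc.\<close>

lemma exp_norm_Ln_le:
  fixes s :: complex
  assumes s: "s \<noteq> 0" "norm s \<le> 2" and B: "0 \<le> B" "B \<le> b"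
  shows "exp (B * norm (Ln s)) \<le> exp (B * pi) * 2 powr (B + b) * norm s powr (-b)"
proof -
  have "norm (Ln s) \<le> \<bar>Re (Ln s)\<bar> + \<bar>Im (Ln s)\<bar>" by (rule cmod_le)
  also have "\<dots> \<le> \<bar>ln (norm s)\<bar> + pi"
    using s mpi_less_Im_Ln[of s] Im_Ln_le_pi[of s] by simp
  finally have "exp (B * norm (Ln s)) \<le> exp (B * (\<bar>ln (norm s)\<bar> + pi))"
    using B by (simp add: mult_left_mono)
  also have "\<dots> = exp (B * pi) * exp (B * \<bar>ln (norm s)\<bar>)"
    by (simp add: exp_add algebra_simps)
  also have "exp (B * \<bar>ln (norm s)\<bar>) \<le> 2 powr (B + b) * norm s powr (-b)"
  proof (cases "norm s \<le> 1")
    case True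
    then have "exp (B * \<bar>ln (norm s)\<bar>) = norm s powr (-B)"
      using s by (simp add: powr_def)
    also have "\<dots> \<le> 1 * norm s powr (-b)" using True s B by (simp add: powr_mono')
    also have "\<dots> \<le> 2 powr (B + b) * norm s powr (-b)"
      using B by (intro mult_right_mono) (auto intro: ge_one_powr_ge_zero)
    finally show ?thesis .
  next
    case False
    then have "exp (B * \<bar>ln (norm s)\<bar>) = norm s powr (B + b) * norm s powr (-b)"
      using s by (simp add: powr_def flip: exp_add) (simp add: algebra_simps)
    also have "\<dots> \<le> 2 powr (B + b) * norm s powr (-b)"
      using B s by (intro mult_right_mono powr_mono2) auto
    finally show ?thesis .
  qed
  finally show ?thesis by (simp add: mult.assoc)
qed

section \<open>The disc coordinate\<close>

text \<open>Since \<open>- Ln (1 - u) / u\<close> is the integral of \<open>1 / (1 - t u)\<close> over \<open>t \<in> [0, 1]\<close>, it stays in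
  the right half-plane, so the principal powers below are holomorphic on the whole disc.\<close>
definition hdisc :: "complex \<Rightarrow> complex" where
  "hdisc u = hfun (- Ln (1 - u))"

lemma one_minus_notin_nonpos:
  fixes u :: complex
  assumes "norm u < 1"
  shows "1 - u \<notin> \<real>\<^sub>\<le>\<^sub>0"
  using assms complex_Re_le_cmod[of u] by (auto simp: complex_nonpos_Reals_iff)

lemma mult_hdisc:
  assumes "norm u < 1"
  shows "u * hdisc u = - Ln (1 - u)"
proof -
  have "1 - u \<noteq> 0" using assms by auto
  then have "exp (Ln (1 - u)) = 1 - u" by simp
  then have "Ln (1 - u) = 0 \<Longrightarrow> u = 0" by auto
  with \<open>1 - u \<noteq> 0\<close> show ?thesis by (auto simp: hdisc_def hfun_def)
qed

lemma hdisc_0 [simp]: "hdisc 0 = 1"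
  by (simp add: hdisc_def hfun_def)

text \<open>For \<open>norm w < 1\<close> the point \<open>1 / (1 - w)\<close> has real part at
  least 1/2, because \<open>(norm (1 - w))\<^sup>2 \<le> 2 * (1 - Re w)\<close>; averaging over
  \<open>w = t * u\<close> preserves the half-plane.\<close>

lemma Re_hdisc_ge:
  assumes u: "norm u < 1"
  shows "Re (hdisc u) \<ge> 1 / 2"
proof (cases "u = 0")
  case False
  have nt: "norm (of_real t * u) < 1" if "t \<in> {0..1}" for t
    using that u mult_left_le_one_le[of "norm u" t] by (simp add: norm_mult)
  have "((\<lambda>t. u / (1 - of_real t * u)) has_integral (- Ln (1 - of_real 1 * u) - (- Ln (1 - of_real 0 * u)))) {0..1}"
  proof (rule fundamental_theorem_of_calculus)
    fix t :: real assume t: "t \<in> {0..1}"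
    show "((\<lambda>t. - Ln (1 - of_real t * u)) has_vector_derivative u / (1 - of_real t * u)) (at t within {0..1})"
      using one_minus_notin_nonpos[OF nt[OF t]]
      by (auto intro!: derivative_eq_intros has_vector_derivative_real_field simp: divide_inverse)
  qed auto
  from has_integral_divide[OF this, of u]
  have "((\<lambda>t. 1 / (1 - of_real t * u)) has_integral hdisc u) {0..1}"
    using False mult_hdisc[OF u, symmetric] by simp
  then have hi: "((\<lambda>t. Re (1 / (1 - of_real t * u))) has_integral Re (hdisc u)) {0..1}"
    by (rule has_integral_Re)
  have "((\<lambda>t::real. 1 / 2) has_integral (1 / 2 :: real)) {0..1}"
    using has_integral_const_real[of "1/2::real" 0 1] by simp
  then show ?thesis
  proof (rule has_integral_le[OF _ hi])
    fix t :: real assume t: "t \<in> {0..1}"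
    define w where "w = of_real t * u"
    have w: "norm w < 1" using nt[OF t] by (simp add: w_def)
    then have "1 - w \<noteq> 0" by auto
    then have p: "(norm (1 - w))\<^sup>2 > 0" by simp
    have "(norm (1 - w))\<^sup>2 = 1 - 2 * Re w + (norm w)\<^sup>2"
      unfolding cmod_power2 by (simp add: power2_eq_square algebra_simps)
    also have "\<dots> \<le> 2 * (1 - Re w)" using w by (simp add: power_le_one)
    finally have "1 / 2 \<le> (1 - Re w) / (norm (1 - w))\<^sup>2" using p by (simp add: field_simps)
    also have "\<dots> = Re (1 / (1 - w))" by (simp add: Re_divide cmod_power2)
    finally show "1 / 2 \<le> Re (1 / (1 - of_real t * u))" by (simp add: w_def)
  qed
qed auto

lemma hdisc_props:
  assumes u: "norm u < 1"
  shows "hdisc u \<noteq> 0" "hdisc u \<notin> \<real>\<^sub>\<le>\<^sub>0" "norm (hdisc u) \<ge> 1 / 2"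
  using Re_hdisc_ge[OF u] complex_Re_le_cmod[of "hdisc u"] by (auto simp: complex_nonpos_Reals_iff)

text \<open>Removable singularity: the value 1 at the origin is the derivative of
  \<open>- Ln (1 - u)\<close> there.\<close>

lemma holomorphic_hdisc: "hdisc holomorphic_on ball 0 1"
proof (rule pole_theorem_0[where g = "\<lambda>u. - Ln (1 - u)" and a = 0])
  show "(\<lambda>u. - Ln (1 - u)) holomorphic_on ball 0 1"
    by (intro holomorphic_intros) (use one_minus_notin_nonpos in auto)
  have "((\<lambda>u. - Ln (1 - u)) has_field_derivative 1) (at 0)"
    by (auto intro!: derivative_eq_intros)
  then show "hdisc 0 = deriv (\<lambda>u. - Ln (1 - u)) 0" by (simp add: DERIV_imp_deriv)
qed (use mult_hdisc in \<open>auto simp: interior_open\<close>)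

text \<open>The lift of \<open>- Ln (1 - v ^ m)\<close> to the covering, in the coordinate
  \<open>w\<close>. Pulling out the factor \<open>v\<close> leaves a root of a function valued in
  the right half-plane, so one single-valued formula serves all \<open>m\<close> sheets.\<close>

definition wroot :: "nat \<Rightarrow> complex \<Rightarrow> complex" where
  "wroot m v = v * hdisc (v ^ m) powr (1 / of_nat m)"

lemma norm_power_less_1: "norm (v::complex) < 1 \<Longrightarrow> m \<ge> 1 \<Longrightarrow> norm (v ^ m) < 1"
  by (simp add: norm_power power_less_one_iff)

lemma powr_inverse_of_nat_power:
  fixes h :: complex
  assumes "h \<noteq> 0"
  shows "(h powr (1 / of_nat m)) ^ k = h powr (of_nat k / of_nat m)"
  using assms by (simp add: powr_def flip: exp_of_nat_mult)

lemma wroot_power: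
  assumes "norm v < 1" "m \<ge> 1"
  shows "wroot m v ^ m = - Ln (1 - v ^ m)"
proof -
  have u: "norm (v ^ m) < 1" using assms by (rule norm_power_less_1)
  have "wroot m v ^ m = v ^ m * hdisc (v ^ m)"
    using assms hdisc_props(1)[OF u]
    by (simp add: wroot_def power_mult_distrib powr_inverse_of_nat_power)
  then show ?thesis using mult_hdisc[OF u] by simp
qed

lemma wroot_in_Omega_star:
  assumes "norm v < 1" "v \<noteq> 0" "m \<ge> 1"
  shows "wroot m v \<in> Omega_star m"
proof -
  have u: "norm (v ^ m) < 1" using assms by (intro norm_power_less_1)
  have "wroot m v \<noteq> 0" using hdisc_props(1)[OF u] assms by (simp add: wroot_def)
  moreover have "1 - v ^ m \<in> ball 1 1" using u by (simp add: dist_norm)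
  ultimately show ?thesis
    unfolding Omega_star_def Delta_def using wroot_power[of v m] assms by auto
qed

lemma holomorphic_wroot:
  assumes "m \<ge> 1"
  shows "wroot m holomorphic_on ball 0 1"
proof -
  have "(hdisc \<circ> (\<lambda>v. v ^ m)) holomorphic_on ball 0 1"
    using norm_power_less_1 assms
    by (intro holomorphic_on_compose_gen[OF _ holomorphic_hdisc]) (auto intro!: holomorphic_intros)
  then show ?thesis
    unfolding wroot_def[abs_def] using hdisc_props(2) norm_power_less_1 assms
    by (intro holomorphic_intros) (auto simp: o_def)
qed

section \<open>The factorial series\<close>

text \<open>Each subseries is padded with zeros to a full series, and the finitely many padded
  series are added; absolute convergence does not enter.\<close>

lemma sums_interlace:
  fixes f :: "nat \<Rightarrow> 'a::real_normed_vector"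
  assumes m: "m \<ge> 1" and s: "\<And>i. i < m \<Longrightarrow> (\<lambda>j. f (i + m * j)) sums s i"
  shows "f sums (\<Sum>i<m. s i)"
proof -
  define g where "g = (\<lambda>i n. if n mod m = i then f n else 0)"
  have "g i sums s i" if i: "i < m" for i
  proof -
    have sub: "strict_mono (\<lambda>j. i + m * j)" using m by (intro strict_monoI) simp
    have "g i n = 0" if "n \<notin> range (\<lambda>j. i + m * j)" for n
    proof -
      have "n mod m \<noteq> i" using that by (metis mod_mult_div_eq rangeI)
      then show ?thesis by (simp add: g_def)
    qed
    from sums_mono_reindex[OF sub, of "g i", OF this] s[OF i] i show ?thesis
      by (simp add: g_def)
  qed
  then have "(\<lambda>n. \<Sum>i<m. g i n) sums (\<Sum>i<m. s i)" by (intro sums_sum) auto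
  moreover have "(\<Sum>i<m. g i n) = f n" for n
    using m by (simp add: g_def)
  ultimately show ?thesis by simp
qed

lemma dcoef_interlaced:
  assumes "i < m"
  shows "dcoef a m (Suc (i + m * j)) = (deriv ^^ j) (\<lambda>u. gfun a m (Suc i) (- Ln (1 - u))) 0 / fact j"
  using assms by (simp add: dcoef_def Let_def)

text \<open>With \<open>w\<close> an m-th root of \<open>\<xi>\<close>, convergence at a slightly
  larger radius \<open>q\<close> makes the full series absolutely convergent at \<open>w\<close>;
  the subseries then converges, and \<open>w ^ i\<close> is divided out. The case
  \<open>\<xi> = 0\<close> is separate, as there is no dividing by \<open>w\<close> there.\<close>

lemma summable_powser_subseries:
  fixes c :: "nat \<Rightarrow> complex"
  assumes sm: "\<And>w. 0 < norm w \<Longrightarrow> norm w < r \<Longrightarrow> summable (\<lambda>n. c n * w ^ n)"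
    and m: "m \<ge> 1" and r: "r > 0" and \<xi>: "norm \<xi> < r ^ m"
  shows "summable (\<lambda>k. c (i + m * k) * \<xi> ^ k)"
proof (cases "\<xi> = 0")
  case False
  define w where "w = \<xi> powr (1 / of_nat m)"
  have wm: "w ^ m = \<xi>" using False m by (simp add: w_def powr_inverse_of_nat_power)
  have w0: "w \<noteq> 0" using False by (simp add: w_def)
  have "norm w ^ m < r ^ m" using \<xi> wm by (simp flip: norm_power)
  then have wr: "norm w < r" using r by (auto intro: power_less_imp_less_base)
  then obtain q where q: "norm w < q" "q < r" using dense by blast
  have "summable (\<lambda>n. c n * of_real q ^ n)"
    using q norm_ge_zero[of w] by (intro sm) (auto simp del: norm_ge_zero)
  then have "summable (\<lambda>n. norm (c n * w ^ n))"
    by (rule powser_insidea) (use q in auto)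
  then have "summable ((\<lambda>n. norm (c n * w ^ n)) \<circ> (\<lambda>k. i + m * k))"
    using m by (intro summable_reindex) (auto simp: inj_on_def)
  then have "summable (\<lambda>k. c (i + m * k) * w ^ (i + m * k))"
    unfolding o_def by (rule summable_norm_cancel)
  moreover have "c (i + m * k) * w ^ (i + m * k) = w ^ i * (c (i + m * k) * \<xi> ^ k)" for k
    by (simp add: power_add power_mult wm)
  ultimately have "summable (\<lambda>k. w ^ i * (c (i + m * k) * \<xi> ^ k))" by simp
  then show ?thesis using w0 by (subst (asm) summable_cmult_iff) auto
qed (rule summable_finite[of "{0}"], auto)

section \<open>Pull-back of the Borel transform to the disc\<close>

text \<open>Off the origin \<open>\<Psi>\<close> is a composite of holomorphic maps. Near the origin
  the germ splits into pieces \<open>w ^ i * S i (w ^ m)\<close>; inserting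
  \<open>w = wroot m v\<close> turns each into \<open>v ^ i\<close> times a function of
  \<open>v ^ m\<close>, namely the one whose Taylor coefficients define
  \<open>dcoef\<close>.\<close>

lemma factorial_disc_expansion:
  assumes m: "m \<ge> 1"
    and hol: "F holomorphic_on Omega_star m"
    and germ: "\<exists>r>0. \<forall>w. 0 < norm w \<and> norm w < r \<longrightarrow>
               (\<lambda>n. a (Suc n) * w ^ Suc n / w ^ m / Gamma (of_nat (Suc n) / of_nat m)) sums F w"
  obtains \<Psi> where "\<Psi> holomorphic_on ball 0 1"
    "\<And>v. v \<noteq> 0 \<Longrightarrow> norm v < 1 \<Longrightarrow> \<Psi> v = F (wroot m v) * v ^ (m - 1)"
    "\<And>n. (deriv ^^ n) \<Psi> 0 / fact n = dcoef a m (Suc n)"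
proof -
  obtain r where r: "r > 0" and
    germ': "\<And>w. 0 < norm w \<Longrightarrow> norm w < r \<Longrightarrow>
       (\<lambda>n. a (Suc n) * w ^ Suc n / w ^ m / Gamma (of_nat (Suc n) / of_nat m)) sums F w"
    using germ by blast
  \<comment> \<open>Multiplication by \<open>w ^ (m - 1)\<close> removes the negative exponents: the
    term with \<open>a (Suc n)\<close> becomes \<open>c n * w ^ n\<close>.\<close>
  define c where "c = (\<lambda>n. a (Suc n) / Gamma (of_nat (Suc n) / of_nat m))"
  have csums: "(\<lambda>n. c n * w ^ n) sums (F w * w ^ (m - 1))" if w: "0 < norm w" "norm w < r" for w
  proof -
    have "w ^ m = w * w ^ (m - 1)" using m by (cases m) auto
    then have "a (Suc n) * w ^ Suc n / w ^ m / Gamma (of_nat (Suc n) / of_nat m) * w ^ (m - 1) = c n * w ^ n" for n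
      using w by (simp add: c_def)
    then show ?thesis using sums_mult2[OF germ'[OF w], of "w ^ (m - 1)"] by simp
  qed
  define S where "S = (\<lambda>i \<xi>. \<Sum>k. c (i + m * k) * \<xi> ^ k)"
  have Ssums: "(\<lambda>k. c (i + m * k) * \<xi> ^ k) sums S i \<xi>" if "norm \<xi> < r ^ m" for i \<xi>
    unfolding S_def using csums m r that
    by (intro summable_sums summable_powser_subseries[where r = r]) (auto simp: sums_iff)
  have Shol: "S i holomorphic_on ball 0 (r ^ m)" for i
    by (rule power_series_holomorphic[where a = "\<lambda>k. c (i + m * k)"]) (use Ssums in auto)
  have Fsplit: "F w * w ^ (m - 1) = (\<Sum>i<m. w ^ i * S i (w ^ m))" if w: "0 < norm w" "norm w < r" for w
  proof -
    have "norm (w ^ m) < r ^ m" using w m by (simp add: norm_power power_strict_mono)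
    then have "(\<lambda>k. w ^ i * (c (i + m * k) * (w ^ m) ^ k)) sums (w ^ i * S i (w ^ m))" for i
      by (intro sums_mult Ssums)
    moreover have "w ^ i * (c (i + m * k) * (w ^ m) ^ k) = c (i + m * k) * w ^ (i + m * k)" for i k
      by (simp add: power_add power_mult)
    ultimately have "(\<lambda>k. c (i + m * k) * w ^ (i + m * k)) sums (w ^ i * S i (w ^ m))" for i
      by simp
    then have "(\<lambda>n. c n * w ^ n) sums (\<Sum>i<m. w ^ i * S i (w ^ m))"
      by (intro sums_interlace m)
    then show ?thesis using csums[OF w] sums_unique2 by blast
  qed
  define \<phi> where "\<phi> = (\<lambda>i u. gfun a m (Suc i) (- Ln (1 - u)))"
  have \<phi>_eq: "\<phi> i u = hdisc u powr (of_nat (Suc i) / of_nat m - 1) * S i (- Ln (1 - u))" for i u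
  proof -
    have "of_nat (Suc i) / of_nat m + of_nat k = (of_nat (Suc (i + m * k)) / of_nat m :: complex)" for k
      using m by (simp add: field_simps)
    then show ?thesis unfolding \<phi>_def gfun_def hdisc_def S_def c_def by simp
  qed
  have "isCont (\<lambda>u::complex. - Ln (1 - u)) 0" by (intro continuous_intros) auto
  then have "((\<lambda>u. - Ln (1 - u)) \<longlongrightarrow> - Ln (1 - 0)) (nhds (0::complex))"
    unfolding isCont_def tendsto_at_iff_tendsto_nhds[of "\<lambda>u. - Ln (1 - u)"] .
  from order_tendstoD(2)[OF tendsto_norm[OF this], of "r ^ m"]
  have "\<forall>\<^sub>F u in nhds (0::complex). norm (- Ln (1 - u)) < r ^ m" using r by simp
  then obtain \<epsilon>0 where \<epsilon>0: "\<epsilon>0 > 0" "\<And>u. norm u < \<epsilon>0 \<Longrightarrow> norm (Ln (1 - u)) < r ^ m"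
    unfolding eventually_nhds_metric by auto
  define \<epsilon> where "\<epsilon> = min \<epsilon>0 1"
  have \<epsilon>: "\<epsilon> > 0" "\<epsilon> \<le> 1" and Ln_less: "\<And>u. norm u < \<epsilon> \<Longrightarrow> norm (Ln (1 - u)) < r ^ m"
    using \<epsilon>0 by (auto simp: \<epsilon>_def)
  have \<phi>hol: "\<phi> i holomorphic_on ball 0 \<epsilon>" for i
  proof -
    have "(S i \<circ> (\<lambda>u. - Ln (1 - u))) holomorphic_on ball 0 \<epsilon>"
    proof (rule holomorphic_on_compose_gen[OF _ Shol])
      show "(\<lambda>u. - Ln (1 - u)) holomorphic_on ball 0 \<epsilon>"
        using one_minus_notin_nonpos \<epsilon> by (intro holomorphic_intros) auto
    qed (use Ln_less in auto)
    moreover have "hdisc holomorphic_on ball 0 \<epsilon>"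
      using holomorphic_hdisc \<epsilon> by (auto intro: holomorphic_on_subset)
    ultimately show ?thesis
      unfolding \<phi>_eq[abs_def] using hdisc_props(2) \<epsilon>
      by (intro holomorphic_intros) (auto simp: o_def)
  qed
  define P where "P = (\<lambda>v. \<Sum>i<m. v ^ i * \<phi> i (v ^ m))"
  \<comment> \<open>The origin needs its own value: \<open>wroot m 0 = 0\<close> lies outside
    \<open>Omega_star m\<close>, where nothing is known about \<open>F\<close>.\<close>
  define \<Psi> where "\<Psi> = (\<lambda>v. if v = 0 then P 0 else F (wroot m v) * v ^ (m - 1))"
  have small: "norm (v ^ m) < \<epsilon>" if "norm v < \<epsilon>" for v :: complex
  proof -
    have "norm v ^ m \<le> norm v ^ 1" using m that \<epsilon> by (intro power_decreasing) auto
    then show ?thesis using that by (simp add: norm_power)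
  qed
  have Psums: "(\<lambda>n. dcoef a m (Suc n) * v ^ n) sums P v" if v: "norm v < \<epsilon>" for v
    unfolding P_def
  proof (rule sums_interlace[OF m])
    fix i assume i: "i < m"
    have "(\<lambda>j. (deriv ^^ j) (\<phi> i) 0 / fact j * (v ^ m - 0) ^ j) sums \<phi> i (v ^ m)"
      by (rule holomorphic_power_series[OF \<phi>hol]) (use small[OF v] in auto)
    moreover have "v ^ i * ((deriv ^^ j) (\<phi> i) 0 / fact j * (v ^ m - 0) ^ j) =
        dcoef a m (Suc (i + m * j)) * v ^ (i + m * j)" for j
      unfolding dcoef_interlaced[OF i] \<phi>_def by (simp add: power_add power_mult)
    ultimately show "(\<lambda>j. dcoef a m (Suc (i + m * j)) * v ^ (i + m * j)) sums (v ^ i * \<phi> i (v ^ m))"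
      using sums_mult[of _ "\<phi> i (v ^ m)" "v ^ i"] by fastforce
  qed
  have \<Psi>P: "\<Psi> v = P v" if v: "norm v < \<epsilon>" for v
  proof (cases "v = 0")
    case False
    have v1: "norm v < 1" using v \<epsilon> by simp
    have u1: "norm (v ^ m) < 1" by (rule norm_power_less_1[OF v1 m])
    define h where "h = hdisc (v ^ m)"
    define q where "q = h powr (1 / of_nat m)"
    have h0: "h \<noteq> 0" using hdisc_props(1)[OF u1] by (simp add: h_def)
    have q0: "q \<noteq> 0" using h0 by (simp add: q_def)
    have W: "wroot m v = v * q" by (simp add: wroot_def q_def h_def)
    have Wm: "wroot m v ^ m = - Ln (1 - v ^ m)" by (rule wroot_power[OF v1 m])
    have "norm (wroot m v) ^ m < r ^ m"
      using Ln_less[OF small[OF v]] Wm by (simp flip: norm_power)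
    then have Wr: "norm (wroot m v) < r" using r by (auto intro: power_less_imp_less_base)
    \<comment> \<open>Exponents add up as \<open>(i + 1) / m - 1 + (m - 1) / m = i / m\<close>. This
      is why \<open>gfun\<close> carries the power \<open>l / m - 1\<close> of \<open>hfun\<close>:
      it balances \<open>q ^ i\<close> from \<open>w ^ i\<close> against
      \<open>q ^ (m - 1)\<close>.\<close>
    have hq: "h powr (of_nat (Suc i) / of_nat m - 1) * q ^ (m - 1) = q ^ i" for i
    proof -
      have "(of_nat (Suc i) / of_nat m - 1) + of_nat (m - 1) / of_nat m = (of_nat i / of_nat m :: complex)"
        using m by (simp add: field_simps of_nat_diff)
      then show ?thesis
        using h0 by (simp add: q_def powr_inverse_of_nat_power flip: powr_add)
    qed
    have "\<Psi> v * q ^ (m - 1) = F (wroot m v) * wroot m v ^ (m - 1)"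
      using False by (simp add: \<Psi>_def W power_mult_distrib)
    also have "\<dots> = (\<Sum>i<m. wroot m v ^ i * S i (- Ln (1 - v ^ m)))"
      using Fsplit[of "wroot m v"] Wr Wm q0 False by (simp add: W)
    also have "\<dots> = (\<Sum>i<m. v ^ i * \<phi> i (v ^ m) * q ^ (m - 1))"
    proof (rule sum.cong)
      fix i
      have "wroot m v ^ i * S i (- Ln (1 - v ^ m)) = v ^ i * S i (- Ln (1 - v ^ m)) * q ^ i"
        by (simp add: W power_mult_distrib)
      also have "\<dots> = v ^ i * \<phi> i (v ^ m) * q ^ (m - 1)"
        unfolding hq[of i, symmetric] \<phi>_eq h_def by (simp add: mult_ac)
      finally show "wroot m v ^ i * S i (- Ln (1 - v ^ m)) = v ^ i * \<phi> i (v ^ m) * q ^ (m - 1)" .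
    qed auto
    also have "\<dots> = P v * q ^ (m - 1)" by (simp add: P_def sum_distrib_right)
    finally show ?thesis using q0 by simp
  qed (simp add: \<Psi>_def)
  have \<Psi>sums: "(\<lambda>n. dcoef a m (Suc n) * v ^ n) sums \<Psi> v" if "norm v < \<epsilon>" for v
    using Psums[OF that] \<Psi>P[OF that] by simp
  have "\<Psi> holomorphic_on ball 0 \<epsilon>"
    by (rule power_series_holomorphic[where a = "\<lambda>n. dcoef a m (Suc n)"]) (use \<Psi>sums in auto)
  moreover have "\<Psi> holomorphic_on (ball 0 1 - {0})"
  proof -
    have "(F \<circ> wroot m) holomorphic_on (ball 0 1 - {0})"
      by (intro holomorphic_on_compose_gen[OF _ hol] holomorphic_on_subset[OF holomorphic_wroot[OF m]]
          image_subsetI wroot_in_Omega_star[OF _ _ m]) auto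
    then have "(\<lambda>v. F (wroot m v) * v ^ (m - 1)) holomorphic_on (ball 0 1 - {0})"
      by (intro holomorphic_intros) (auto simp: o_def)
    then show ?thesis by (rule holomorphic_transform) (auto simp: \<Psi>_def)
  qed
  ultimately have "\<Psi> holomorphic_on (ball 0 \<epsilon> \<union> (ball 0 1 - {0}))"
    by (intro holomorphic_on_Un) auto
  then have "\<Psi> holomorphic_on ball 0 1"
    by (rule holomorphic_on_subset) (use \<epsilon> in auto)
  moreover have "(deriv ^^ n) \<Psi> 0 / fact n = dcoef a m (Suc n)" for n
  proof -
    have "\<forall>\<^sub>F v in nhds 0. (\<lambda>n. fps_nth (Abs_fps (\<lambda>n. dcoef a m (Suc n))) n * v ^ n) sums \<Psi> v"
      using \<Psi>sums \<epsilon> unfolding eventually_nhds_metric by auto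
    then have "\<Psi> has_fps_expansion Abs_fps (\<lambda>n. dcoef a m (Suc n))" by (rule has_fps_expansionI)
    from fps_nth_fps_expansion[OF this, of n] show ?thesis by simp
  qed
  ultimately show ?thesis by (intro that[of \<Psi>]) (auto simp: \<Psi>_def)
qed

section \<open>The Laplace ray and the Borel sum\<close>

text \<open>The ray \<open>arg \<zeta> = 0\<close> corresponds to the radius (0, 1) of the disc. For
  \<open>u = 1 - exp (-t)\<close> one has \<open>hdisc u = t / u\<close>, so all principal roots are
  roots of positive reals.\<close>

lemma wroot_of_real:
  fixes t :: real
  assumes t: "t > 0" and m: "m \<ge> 1"
  shows "wroot m (of_real (root m (1 - exp (-t)))) = of_real (root m t)"
proof -
  define u where "u = 1 - exp (-t)"
  have u: "0 < u" "u < 1" using t by (auto simp: u_def)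
  have um: "complex_of_real (root m u) ^ m = of_real u"
    using u m by (simp flip: of_real_power)
  have "complex_of_real u * hdisc (of_real u) = - Ln (1 - of_real u)"
    using u by (intro mult_hdisc) auto
  also have "1 - complex_of_real u = of_real (exp (-t))" by (simp add: u_def)
  also have "- Ln (of_real (exp (-t))) = complex_of_real t"
    by (subst Ln_of_real) auto
  finally have "hdisc (of_real u) = of_real (t / u)" using u by (simp add: field_simps)
  then have "wroot m (of_real (root m u)) = of_real (root m u) * of_real (t / u) powr of_real (1 / real m)"
    by (simp add: wroot_def um)
  also have "\<dots> = of_real (root m u * root m (t / u))"
    using t u m by (subst powr_of_real) (auto simp: root_powr_inverse)
  also have "root m u * root m (t / u) = root m t"
    using u m by (simp flip: real_root_mult)
  finally show ?thesis by (simp add: u_def)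
qed

text \<open>\<open>F\<close> is the Borel transform in the coordinate \<open>w\<close> with
  \<open>\<zeta> = w ^ m\<close>: the power \<open>n / m - 1\<close> of \<open>\<zeta>\<close> reads
  \<open>w ^ n / w ^ m\<close>, and the weight in the growth bound reads \<open>w ^ (m - 1)\<close>.
  The point \<open>z\<close> enters through its projection only, so \<open>P\<close> becomes a
  half-plane.\<close>

theorem proposition5p2:
  fixes m :: nat and a :: "nat \<Rightarrow> complex" and F :: "complex \<Rightarrow> complex"
    and A B :: real
  assumes m: "m \<ge> 1"
    and gev: "gevrey1 m a"
    and hol: "F holomorphic_on Omega_star m"
    and germ: "\<exists>r>0. \<forall>w. 0 < norm w \<and> norm w < r \<longrightarrow>
               (\<lambda>n. a (Suc n) * w ^ Suc n / w ^ m / Gamma (of_nat (Suc n) / of_nat m)) sums F w"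
    and A: "A > 0" and B: "B > 0"
    and bound: "\<forall>w \<in> Omega_star m. norm (F w * w ^ (m - 1)) \<le> A * exp (B * norm w ^ m)"
  shows "\<forall>z. Re z > max B 1 \<longrightarrow>
    summable (\<lambda>n. norm (Gamma (of_nat (Suc n) / of_nat m) * Gamma z * dcoef a m (Suc n)
                         / Gamma (z + of_nat (Suc n) / of_nat m))) \<and>
    (\<exists>I. ((\<lambda>t. F (of_real (root m t)) * exp (- z * of_real t)) has_integral I) {0<..} \<and>
         a 0 + (\<Sum>n. Gamma (of_nat (Suc n) / of_nat m) * Gamma z * dcoef a m (Suc n)
                         / Gamma (z + of_nat (Suc n) / of_nat m)) = a 0 + I)"
proof (intro allI impI)
  fix z :: complex assume z: "Re z > max B 1"
  obtain \<Psi> where \<Psi>: "\<Psi> holomorphic_on ball 0 1"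
      "\<And>v. v \<noteq> 0 \<Longrightarrow> norm v < 1 \<Longrightarrow> \<Psi> v = F (wroot m v) * v ^ (m - 1)"
      "\<And>n. (deriv ^^ n) \<Psi> 0 / fact n = dcoef a m (Suc n)"
    using factorial_disc_expansion[OF m hol germ] by blast
  define x where "x = Re z"
  \<comment> \<open>The midpoint of \<open>max B 1\<close> and \<open>x\<close>: the coefficient
    estimate needs \<open>b > 1\<close>, the growth bound needs \<open>B \<le> b\<close>, and
    summability needs \<open>b < x\<close>.\<close>
  define b where "b = (max B 1 + x) / 2"
  have b: "b > 1" "B \<le> b" "b < x" and x: "x > 0" using z by (auto simp: b_def x_def)
  \<comment> \<open>The first entry covers \<open>v = 0\<close>; the 2 in the second offsets the
    lower bound 1/2 for \<open>norm q ^ (m - 1)\<close>.\<close>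
  define C where "C = max (norm (\<Psi> 0)) (2 * A * (exp (B * pi) * 2 powr (B + b)))"
  have \<Psi>bound: "norm (\<Psi> v) \<le> C * norm (1 - v ^ m) powr (-b)" if v: "norm v < 1" for v
  proof (cases "v = 0")
    case True
    then show ?thesis using m by (simp add: C_def power_0_left)
  next
    case False
    have u: "norm (v ^ m) < 1" by (rule norm_power_less_1[OF v m])
    define q where "q = hdisc (v ^ m) powr (1 / of_nat m)"
    have h: "hdisc (v ^ m) \<noteq> 0" "norm (hdisc (v ^ m)) \<ge> 1 / 2" by (rule hdisc_props[OF u])+
    \<comment> \<open>The hypothesis controls \<open>F w * w ^ (m - 1)\<close>, whereas
      \<open>\<Psi>\<close> carries \<open>v ^ (m - 1)\<close>; their quotient
      \<open>q ^ (m - 1)\<close> must stay away from 0.\<close>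
    have nq: "norm q ^ (m - 1) \<ge> 1 / 2"
    proof -
      have "norm q ^ m = norm (hdisc (v ^ m))"
        using h m by (simp add: q_def powr_inverse_of_nat_power flip: norm_power)
      then have qm: "norm q ^ m \<ge> 1 / 2" using h by simp
      show ?thesis
      proof (cases "norm q \<le> 1")
        case True
        then have "norm q ^ m \<le> norm q ^ (m - 1)" by (intro power_decreasing) auto
        then show ?thesis using qm by simp
      next
        case False
        then have "1 \<le> norm q ^ (m - 1)" by (intro one_le_power) auto
        then show ?thesis by linarith
      qed
    qed
    have W: "wroot m v = v * q" by (simp add: wroot_def q_def)
    have "norm (\<Psi> v) * (1 / 2) \<le> norm (\<Psi> v) * norm q ^ (m - 1)"
      using nq by (intro mult_left_mono) auto
    also have "\<dots> = norm (F (wroot m v) * wroot m v ^ (m - 1))"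
      using \<Psi>(2)[OF False v] by (simp add: W norm_mult norm_power power_mult_distrib)
    also have "\<dots> \<le> A * exp (B * norm (wroot m v) ^ m)"
      using bound wroot_in_Omega_star[OF v False m] by blast
    also have "norm (wroot m v) ^ m = norm (Ln (1 - v ^ m))"
      using wroot_power[OF v m] by (simp flip: norm_power)
    also have "A * exp (B * norm (Ln (1 - v ^ m))) \<le>
        A * (exp (B * pi) * 2 powr (B + b) * norm (1 - v ^ m) powr (-b))"
    proof (intro mult_left_mono exp_norm_Ln_le)
      show "1 - v ^ m \<noteq> 0" using u by auto
      show "norm (1 - v ^ m) \<le> 2" using norm_triangle_ineq4[of 1 "v ^ m"] u by simp
    qed (use A B b in auto)
    finally have "norm (\<Psi> v) \<le> 2 * A * (exp (B * pi) * 2 powr (B + b)) * norm (1 - v ^ m) powr (-b)"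
      by simp
    also have "\<dots> \<le> C * norm (1 - v ^ m) powr (-b)"
      by (intro mult_right_mono) (auto simp: C_def)
    finally show ?thesis .
  qed
  obtain K where K: "K \<ge> 0" "\<And>n. norm (dcoef a m (Suc n)) \<le> K * real (Suc n) powr (b - 1)"
    using taylor_coeff_powr_bound[OF \<Psi>(1) m b(1) \<Psi>bound] unfolding \<Psi>(3) by blast
  obtain L where L: "L \<ge> 0" "\<And>n. n \<ge> 1 \<Longrightarrow> Beta (real n / real m) x \<le> L * real n powr (- x)"
    using Beta_powr_bound[OF x m] by blast
  define al where "al = (\<lambda>n. real (Suc n) / real m)"
  have al: "al n > 0" for n using m by (simp add: al_def)
  have Bsum: "summable (\<lambda>n. norm (dcoef a m (Suc n)) * Beta (al n) x)"
  proof (rule summable_comparison_test')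
    \<comment> \<open>The coefficient and Beta bounds multiply to the exponent
      \<open>b - 1 - x\<close>, which is below -1.\<close>
    have "summable (\<lambda>n. real n powr (b - 1 - x))"
      using b by (subst summable_real_powr_iff) auto
    then have "summable (\<lambda>n. real (Suc n) powr (b - 1 - x))" by (subst summable_Suc_iff)
    then show "summable (\<lambda>n. K * L * real (Suc n) powr (b - 1 - x))" by (rule summable_mult)
    fix n
    have "norm (norm (dcoef a m (Suc n)) * Beta (al n) x) = norm (dcoef a m (Suc n)) * Beta (al n) x"
      using Beta_real_nonneg[OF al[of n] x] by simp
    also have "\<dots> \<le> (K * real (Suc n) powr (b - 1)) * (L * real (Suc n) powr (- x))"
      using K L(2)[of "Suc n"] Beta_real_nonneg[OF al[of n] x]
      by (intro mult_mono) (auto simp: al_def)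
    also have "\<dots> = K * L * real (Suc n) powr (b - 1 - x)"
      by (simp add: mult_ac flip: powr_add)
    finally show "norm (norm (dcoef a m (Suc n)) * Beta (al n) x) \<le> K * L * real (Suc n) powr (b - 1 - x)" .
  qed
  have term_eq: "Gamma (of_nat (Suc n) / of_nat m) * Gamma z * dcoef a m (Suc n)
      / Gamma (z + of_nat (Suc n) / of_nat m) = dcoef a m (Suc n) * Beta (of_real (al n)) z" for n
    by (simp add: Beta_def al_def add.commute)
  have sum1: "summable (\<lambda>n. norm (dcoef a m (Suc n) * Beta (of_real (al n)) z))"
  proof (rule summable_comparison_test'[OF Bsum])
    show "norm (norm (dcoef a m (Suc n) * Beta (of_real (al n)) z)) \<le> norm (dcoef a m (Suc n)) * Beta (al n) x" for n
      using norm_Beta_le[OF al[of n], of z] x by (simp add: norm_mult mult_left_mono x_def)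
  qed
  define f where "f = (\<lambda>n t. dcoef a m (Suc n) *
      (of_real ((1 - exp (-t)) powr (al n - 1)) * exp (- z * of_real t)))"
  have xz: "Re z > 0" using x by (simp add: x_def)
  have fint: "f n absolutely_integrable_on {0<..}" for n
    unfolding f_def using Beta_laplace_absolutely_integrable[OF al[of n] xz]
    by (intro set_integrable_mult_right) auto
  have fval: "integral {0<..} (f n) = dcoef a m (Suc n) * Beta (of_real (al n)) z" for n
    unfolding f_def integral_mult_right Beta_laplace_complex[OF al xz] ..
  have fnorm: "integral {0<..} (\<lambda>t. norm (f n t)) = norm (dcoef a m (Suc n)) * Beta (al n) x" for n
  proof -
    have "norm (f n t) = norm (dcoef a m (Suc n)) * ((1 - exp (-t)) powr (al n - 1) * exp (- x * t))" for t
      unfolding f_def norm_mult[of "dcoef a m (Suc n)"] norm_Beta_laplace_integrand x_def ..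
    then show ?thesis
      using integral_unique[OF Beta_laplace_real[OF al[of n] x]] by simp
  qed
  have pw: "summable (\<lambda>n. norm (f n t)) \<and> (\<lambda>n. f n t) sums (F (of_real (root m t)) * exp (- z * of_real t))"
    if t: "t > 0" for t
  proof -
    define u where "u = 1 - exp (-t)"
    have u: "0 < u" "u < 1" using t by (auto simp: u_def)
    define v where "v = complex_of_real (root m u)"
    have nv: "norm v < 1" using u m by (simp add: v_def)
    have v0: "v \<noteq> 0" using u m by (simp add: v_def)
    have ser: "(\<lambda>n. dcoef a m (Suc n) * w ^ n) sums \<Psi> w" if "norm w < 1" for w
      using holomorphic_power_series[OF \<Psi>(1), of w] that by (simp add: \<Psi>(3))
    obtain q where q: "norm v < q" "q < 1" using dense[OF nv] by blast
    have "summable (\<lambda>n. dcoef a m (Suc n) * of_real q ^ n)"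
      using ser[of "of_real q"] q norm_ge_zero[of v] by (auto simp: sums_iff simp del: norm_ge_zero)
    then have nsum: "summable (\<lambda>n. norm (dcoef a m (Suc n) * v ^ n))"
      by (rule powser_insidea) (use q in auto)
    \<comment> \<open>Index shift: \<open>v ^ n\<close> belongs to \<open>dcoef a m (Suc n)\<close>,
      so dividing by \<open>v ^ (m - 1)\<close> yields the exponent \<open>(n + 1) / m - 1\<close>
      of the Beta integrand.\<close>
    have vp: "v ^ n / v ^ (m - 1) = of_real (u powr (al n - 1))" for n
    proof -
      have "v ^ k = of_real (u powr (real k / real m))" for k
        using u m by (simp add: v_def root_powr_inverse powr_powr flip: powr_realpow of_real_power)
      then have "v ^ n / v ^ (m - 1) = of_real (u powr (real n / real m) / u powr (real (m - 1) / real m))"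
        by simp
      also have "u powr (real n / real m) / u powr (real (m - 1) / real m) =
          u powr (real n / real m - real (m - 1) / real m)" by (rule powr_diff[symmetric])
      also have "real n / real m - real (m - 1) / real m = al n - 1"
        using m by (simp add: al_def field_simps of_nat_diff)
      finally show ?thesis .
    qed
    have feq: "f n t = exp (- z * of_real t) / v ^ (m - 1) * (dcoef a m (Suc n) * v ^ n)" for n
      unfolding f_def u_def[symmetric] vp[symmetric] by simp
    have "F (of_real (root m t)) = \<Psi> v / v ^ (m - 1)"
      using \<Psi>(2)[OF v0 nv] wroot_of_real[OF t m] v0 by (simp add: v_def u_def)
    then have "(\<lambda>n. f n t) sums (F (of_real (root m t)) * exp (- z * of_real t))"
      unfolding feq using sums_mult[OF ser[OF nv], of "exp (- z * of_real t) / v ^ (m - 1)"]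
      by (simp add: mult_ac)
    moreover have "summable (\<lambda>n. norm (f n t))"
      unfolding feq norm_mult[of "exp (- z * of_real t) / v ^ (m - 1)"] by (intro summable_mult nsum)
    ultimately show ?thesis by blast
  qed
  have smi: "summable (\<lambda>n. integral {0<..} (\<lambda>t. norm (f n t)))"
    unfolding fnorm by (rule Bsum)
  have int: "(\<lambda>t. \<Sum>n. f n t) absolutely_integrable_on {0<..}"
    by (rule absolutely_integrable_suminf) (use fint smi pw in auto)
  have sums: "(\<lambda>n. integral {0<..} (f n)) sums integral {0<..} (\<lambda>t. \<Sum>n. f n t)"
    by (rule sums_integral_on) (use fint smi pw in auto)
  have "((\<lambda>t. \<Sum>n. f n t) has_integral integral {0<..} (\<lambda>t. \<Sum>n. f n t)) {0<..}"
    using set_lebesgue_integral_eq_integral(1)[OF int] by (rule integrable_integral)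
  then have hi: "((\<lambda>t. F (of_real (root m t)) * exp (- z * of_real t)) has_integral
      (\<Sum>n. dcoef a m (Suc n) * Beta (of_real (al n)) z)) {0<..}"
    unfolding sums_unique[OF sums, unfolded fval, symmetric]
    by (rule has_integral_eq[rotated]) (use pw in \<open>auto simp: sums_iff\<close>)
  show "summable (\<lambda>n. norm (Gamma (of_nat (Suc n) / of_nat m) * Gamma z * dcoef a m (Suc n)
                         / Gamma (z + of_nat (Suc n) / of_nat m))) \<and>
    (\<exists>I. ((\<lambda>t. F (of_real (root m t)) * exp (- z * of_real t)) has_integral I) {0<..} \<and>
         a 0 + (\<Sum>n. Gamma (of_nat (Suc n) / of_nat m) * Gamma z * dcoef a m (Suc n)
                         / Gamma (z + of_nat (Suc n) / of_nat m)) = a 0 + I)"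
    unfolding term_eq using sum1 hi by blast
qed

end
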